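(* Let $\mu$ be a Borel probability measure on $\mathbb{R}^d$. If $\mu$ has a Bessel measure (respectively, a frame measure), then it has a Bessel measure (respectively, a frame measure) which is absolutely continuous with respect to the Lebesgue measure on $\mathbb{R}^d$ and whose Radon-Nikodym derivative is $C^\infty$.
   Context: For $f\in L^1(\mu)$, put $\widehat{f\,d\mu}(t)=\int f(x)e^{-2\pi i t\cdot x}\,d\mu(x)$, $t\in\mathbb{R}^d$. A (nonnegative) Borel measure $\nu$ on $\mathbb{R}^d$ is a Bessel measure for $\mu$ if there is a constant $B>0$ such that $\|\widehat{f\,d\mu}\|_{L^2(\nu)}^2\le B\|f\|_{L^2(\mu)}^2$ for every $f\in L^2(\mu)$. It is a frame measure for $\mu$ if there are constants $A,B>0$ such that $A\|f\|_{L^2(\mu)}^2\le \|\widehat{f\,d\mu}\|_{L^2(\nu)}^2\le B\|f\|_{L^2(\mu)}^2$ for every $f\in L^2(\mu)$. *)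

theory Defs
  imports "HOL-Probability.Probability"
begin

text \<open>
  Elements of $L^p(\mu)$ are represented by complex-valued functions rather than by classes
  modulo equality almost everywhere; the transform and the norms below do not depend on the
  chosen representative.
\<close>

definition L2 :: "'a measure \<Rightarrow> ('a \<Rightarrow> complex) set" where
  "L2 M = {f \<in> borel_measurable M. integrable M (\<lambda>x. (cmod (f x))\<^sup>2)}"

definition L2_norm_sq :: "'a measure \<Rightarrow> ('a \<Rightarrow> complex) \<Rightarrow> ennreal" where
  "L2_norm_sq M f = (\<integral>\<^sup>+ x. ennreal ((cmod (f x))\<^sup>2) \<partial>M)"

text \<open>
  Only meaningful for integrable \<open>f\<close>; when \<open>\<mu>\<close> is finite this includes all of \<open>L2 \<mu>\<close>.
\<close>

definition fourier :: "'a::euclidean_space measure \<Rightarrow> ('a \<Rightarrow> complex) \<Rightarrow> 'a \<Rightarrow> complex" where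
  "fourier \<mu> f t = (LINT x|\<mu>. f x * exp (- (2 * complex_of_real pi * \<i> * complex_of_real (t \<bullet> x))))"

text \<open>
  The measure \<open>\<nu>\<close> is not required to be finite or \<open>\<sigma>\<close>-finite. The squared norm in \<open>L2 \<nu>\<close> is
  taken in \<^typ>\<open>ennreal\<close>, so the upper bounds include the assertion that it is finite.
\<close>

definition bessel_measure :: "'a::euclidean_space measure \<Rightarrow> 'a measure \<Rightarrow> bool" where
  "bessel_measure \<mu> \<nu> \<longleftrightarrow> sets \<nu> = sets borel \<and>
     (\<exists>B::real. B > 0 \<and>
       (\<forall>f \<in> L2 \<mu>. L2_norm_sq \<nu> (fourier \<mu> f) \<le> ennreal B * L2_norm_sq \<mu> f))"

definition frame_measure :: "'a::euclidean_space measure \<Rightarrow> 'a measure \<Rightarrow> bool" where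
  "frame_measure \<mu> \<nu> \<longleftrightarrow> sets \<nu> = sets borel \<and>
     (\<exists>A B::real. A > 0 \<and> B > 0 \<and>
       (\<forall>f \<in> L2 \<mu>. ennreal A * L2_norm_sq \<mu> f \<le> L2_norm_sq \<nu> (fourier \<mu> f) \<and>
                   L2_norm_sq \<nu> (fourier \<mu> f) \<le> ennreal B * L2_norm_sq \<mu> f))"

text \<open>
  \<open>C_k k f\<close>: the function \<open>f\<close> is \<open>k\<close> times continuously differentiable on the whole space;
  it is $C^{k+1}$ iff it is differentiable and all its directional derivatives are $C^k$.
\<close>

primrec C_k :: "nat \<Rightarrow> ('a::euclidean_space \<Rightarrow> real) \<Rightarrow> bool" where
  "C_k 0 f \<longleftrightarrow> continuous_on UNIV f"
| "C_k (Suc k) f \<longleftrightarrow> (\<forall>x. f differentiable (at x)) \<and>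
     (\<forall>v. C_k k (\<lambda>x. frechet_derivative f (at x) v))"

definition C_infinity :: "('a::euclidean_space \<Rightarrow> real) \<Rightarrow> bool" where
  "C_infinity f \<longleftrightarrow> (\<forall>k. C_k k f)"

text \<open>
  The Radon-Nikodym derivative is only determined up to Lebesgue null sets, so smoothness means
  that it has a smooth version. Without \<open>0 \<le> g x\<close> the truncation
  \<open>ennreal (g x) = ennreal (max 0 (g x))\<close> would admit derivatives that are merely positive
  parts of smooth functions.
\<close>

definition ac_with_smooth_RN_deriv :: "'a::euclidean_space measure \<Rightarrow> bool" where
  "ac_with_smooth_RN_deriv \<nu> \<longleftrightarrow> absolutely_continuous lborel \<nu> \<and>
     (\<exists>g. C_infinity g \<and> (\<forall>x. 0 \<le> g x) \<and>
          (AE x in lborel. RN_deriv lborel \<nu> x = ennreal (g x)))"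

end

theory Submission
  imports Defs
begin

text \<open>
  Translating a measure \<open>\<nu>\<close> by \<open>u\<close> leaves its Bessel and frame bounds unchanged: evaluating the
  transform of \<open>f\<close> at \<open>u + s\<close> amounts to evaluating at \<open>s\<close> the transform of \<open>f\<close> multiplied by a
  character, and multiplication by a character preserves the norm in \<open>L\<^sup>2(\<mu>)\<close>. The bounds therefore
  survive averaging of the translates against any weight \<open>\<rho> \<ge> 0\<close> of finite positive mass \<open>I\<close>, up to
  the factor \<open>I\<close>. The averaged measure is the convolution of \<open>\<rho>\<close> and \<open>\<nu>\<close>; it has the density
  \<open>t \<mapsto> \<integral> \<rho>(t - s) d\<nu>(s)\<close>, which inherits its smoothness from \<open>\<rho>\<close>. Here \<open>\<rho>(x) = exp (- \<bar>x\<bar>\<^sup>2)\<close>.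

  Two points need care. First, \<open>\<nu>\<close> is not assumed \<open>\<sigma>\<close>-finite, but the upper bound forces it to be,
  and more (\<open>bessel_imp_translation_bounded\<close>): applied to the character with frequency \<open>a\<close>, whose
  transform is the transform of \<open>\<mu>\<close> shifted to \<open>a\<close> and hence is bounded away from \<open>0\<close> near \<open>a\<close>, it
  bounds the \<open>\<nu>\<close>-measure of all balls of one fixed radius uniformly. Consequently Tonelli's theorem
  applies, and \<open>\<nu>\<close> integrates \<open>exp (- d \<bar>s\<bar>)\<close>, where \<open>d\<close> is the dimension
  (\<open>translation_bounded_exp_norm_integrable\<close>).

  Second, the density has to be differentiated under the integral sign arbitrarily often. The products
  of polynomials with the Gaussian form a class closed under directional derivatives, and each member
  is dominated, locally uniformly under translation, by a multiple of the integrable weight above. One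
  differentiation step (\<open>smoothing_has_derivative\<close>) within this class thus suffices, and
  induction yields all orders.
\<close>

section \<open>Gaussian polynomials\<close>

text \<open>
  The polynomials times the Gaussian, generated by steps for which closure under differentiation and
  rapid decay are immediate by induction.
\<close>

inductive_set gauss_poly :: "('a::euclidean_space \<Rightarrow> real) set" where
  gauss: "(\<lambda>x. exp (- (norm x)\<^sup>2)) \<in> gauss_poly"
| inner_mult: "\<phi> \<in> gauss_poly \<Longrightarrow> (\<lambda>x. (v \<bullet> x) * \<phi> x) \<in> gauss_poly"
| add: "\<phi> \<in> gauss_poly \<Longrightarrow> \<psi> \<in> gauss_poly \<Longrightarrow> (\<lambda>x. \<phi> x + \<psi> x) \<in> gauss_poly"
| scale: "\<phi> \<in> gauss_poly \<Longrightarrow> (\<lambda>x. c * \<phi> x) \<in> gauss_poly"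

lemma gauss_poly_derivative:
  assumes "\<phi> \<in> gauss_poly"
  shows "\<exists>\<phi>'. (\<forall>x. (\<phi> has_derivative \<phi>' x) (at x)) \<and> (\<forall>v. (\<lambda>x. \<phi>' x v) \<in> gauss_poly)"
  using assms
proof induction
  case gauss
  have "((\<lambda>x::'a. exp (- (norm x)\<^sup>2)) has_derivative (\<lambda>v. ((- 2 *\<^sub>R v) \<bullet> x) * exp (- (norm x)\<^sup>2))) (at x)" for x
    unfolding power2_norm_eq_inner
    by (auto intro!: derivative_eq_intros simp: inner_commute)
  moreover have "(\<lambda>x::'a. ((- 2 *\<^sub>R v) \<bullet> x) * exp (- (norm x)\<^sup>2)) \<in> gauss_poly" for v
    by (intro gauss_poly.intros)
  ultimately show ?case
    by (intro exI[of _ "\<lambda>x v. ((- 2 *\<^sub>R v) \<bullet> x) * exp (- (norm x)\<^sup>2)"]) blast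
next
  case (inner_mult \<phi> w)
  then obtain \<phi>' where \<phi>': "\<And>x. (\<phi> has_derivative \<phi>' x) (at x)" "\<And>v. (\<lambda>x. \<phi>' x v) \<in> gauss_poly"
    by blast
  have "((\<lambda>x. (w \<bullet> x) * \<phi> x) has_derivative (\<lambda>v. (w \<bullet> v) * \<phi> x + (w \<bullet> x) * \<phi>' x v)) (at x)" for x
    by (auto intro!: derivative_eq_intros \<phi>'(1))
  moreover have "(\<lambda>x. (w \<bullet> v) * \<phi> x + (w \<bullet> x) * \<phi>' x v) \<in> gauss_poly" for v
    by (intro gauss_poly.intros inner_mult \<phi>')
  ultimately show ?case
    by (intro exI[of _ "\<lambda>x v. (w \<bullet> v) * \<phi> x + (w \<bullet> x) * \<phi>' x v"]) blast
next
  case (add \<phi> \<psi>)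
  then obtain \<phi>' \<psi>' where \<phi>': "\<And>x. (\<phi> has_derivative \<phi>' x) (at x)" "\<And>v. (\<lambda>x. \<phi>' x v) \<in> gauss_poly"
    and \<psi>': "\<And>x. (\<psi> has_derivative \<psi>' x) (at x)" "\<And>v. (\<lambda>x. \<psi>' x v) \<in> gauss_poly"
    by blast
  show ?case
    by (intro exI[of _ "\<lambda>x v. \<phi>' x v + \<psi>' x v"] conjI allI has_derivative_add gauss_poly.add \<phi>' \<psi>')
next
  case (scale \<phi> c)
  then obtain \<phi>' where \<phi>': "\<And>x. (\<phi> has_derivative \<phi>' x) (at x)" "\<And>v. (\<lambda>x. \<phi>' x v) \<in> gauss_poly"
    by blast
  show ?case
    by (intro exI[of _ "\<lambda>x v. c * \<phi>' x v"] conjI allI has_derivative_mult_right gauss_poly.scale \<phi>')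
qed

lemma gauss_poly_continuous:
  assumes "\<phi> \<in> gauss_poly"
  shows "continuous_on UNIV \<phi>"
  using gauss_poly_derivative[OF assms]
  by (metis has_derivative_continuous continuous_at_imp_continuous_on)

lemma gauss_poly_measurable:
  "\<phi> \<in> gauss_poly \<Longrightarrow> \<phi> \<in> borel_measurable borel"
  by (intro borel_measurable_continuous_onI gauss_poly_continuous)

text \<open>
  The rate \<open>a\<close> is arbitrary because a linear factor costs one unit of it (\<open>\<bar>x\<bar> \<le> exp \<bar>x\<bar>\<close>), so the
  induction hypothesis is applied with \<open>a + 1\<close>.
\<close>

lemma gauss_poly_decay:
  assumes "\<phi> \<in> gauss_poly"
  shows "\<exists>C\<ge>0. \<forall>x. \<bar>\<phi> x\<bar> \<le> C * exp (- a * norm x)"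
  using assms
proof (induction arbitrary: a)
  case gauss
  have "exp (- (norm x)\<^sup>2) \<le> exp (a\<^sup>2 / 4) * exp (- a * norm x)" for x :: 'a
  proof -
    have "0 \<le> (norm x - a / 2)\<^sup>2" by simp
    also have "\<dots> = (norm x)\<^sup>2 - a * norm x + a\<^sup>2 / 4"
      by (simp add: power2_diff power_divide algebra_simps)
    finally show ?thesis by (simp flip: exp_add)
  qed
  then show ?case by (intro exI[of _ "exp (a\<^sup>2 / 4)"]) simp
next
  case (inner_mult \<phi> v)
  obtain C where C: "C \<ge> 0" "\<And>x. \<bar>\<phi> x\<bar> \<le> C * exp (- (a + 1) * norm x)"
    using inner_mult.IH[of "a + 1"] by blast
  have "\<bar>(v \<bullet> x) * \<phi> x\<bar> \<le> (norm v * C) * exp (- a * norm x)" for x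
  proof -
    have "norm x \<le> exp (norm x)"
      using exp_ge_add_one_self[of "norm x"] by linarith
    then have "\<bar>v \<bullet> x\<bar> \<le> norm v * exp (norm x)"
      by (meson Cauchy_Schwarz_ineq2 mult_left_mono norm_ge_zero order_trans)
    then have "\<bar>(v \<bullet> x) * \<phi> x\<bar> \<le> (norm v * exp (norm x)) * (C * exp (- (a + 1) * norm x))"
      unfolding abs_mult using C by (intro mult_mono) auto
    also have "\<dots> = (norm v * C) * exp (- a * norm x)"
      by (simp add: algebra_simps flip: exp_add)
    finally show ?thesis .
  qed
  with C(1) show ?case by (intro exI[of _ "norm v * C"]) auto
next
  case (add \<phi> \<psi>)
  obtain C D where C: "C \<ge> 0" "\<And>x. \<bar>\<phi> x\<bar> \<le> C * exp (- a * norm x)"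
    and D: "D \<ge> 0" "\<And>x. \<bar>\<psi> x\<bar> \<le> D * exp (- a * norm x)"
    using add.IH[of a] by blast
  have "\<bar>\<phi> x + \<psi> x\<bar> \<le> (C + D) * exp (- a * norm x)" for x
    using C(2)[of x] D(2)[of x] by (simp add: algebra_simps)
  with C(1) D(1) show ?case by (intro exI[of _ "C + D"]) auto
next
  case (scale \<phi> c)
  obtain C where C: "C \<ge> 0" "\<And>x. \<bar>\<phi> x\<bar> \<le> C * exp (- a * norm x)"
    using scale.IH[of a] by blast
  have "\<bar>c * \<phi> x\<bar> \<le> (\<bar>c\<bar> * C) * exp (- a * norm x)" for x
    unfolding abs_mult using mult_left_mono[OF C(2), of "\<bar>c\<bar>" x] by (simp add: algebra_simps)
  with C(1) show ?case by (intro exI[of _ "\<bar>c\<bar> * C"]) auto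
qed

section \<open>Translation-bounded measures\<close>

definition translation_bounded :: "'a::euclidean_space measure \<Rightarrow> bool" where
  "translation_bounded \<nu> \<longleftrightarrow> sets \<nu> = sets borel \<and>
     (\<exists>r>0. \<exists>C::real. \<forall>a. emeasure \<nu> (ball a r) \<le> ennreal C)"

text \<open>
  The balls of the given radius about a countable dense set cover the space.
\<close>

lemma translation_bounded_sigma_finite:
  assumes "translation_bounded (\<nu> :: 'a::euclidean_space measure)"
  shows "sigma_finite_measure \<nu>"
proof -
  obtain r C where sets[measurable_cong]: "sets \<nu> = sets borel"
    and r: "r > 0" "\<And>a. emeasure \<nu> (ball a r) \<le> ennreal C"
    using assms unfolding translation_bounded_def by blast
  obtain D :: "'a set" where D: "countable D" "\<And>X. open X \<Longrightarrow> X \<noteq> {} \<Longrightarrow> \<exists>d\<in>D. d \<in> X"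
    using countable_dense_exists by blast
  have "x \<in> (\<Union>d\<in>D. ball d r)" for x
    using D(2)[of "ball x r"] r(1) by (auto simp: dist_commute)
  then have "(\<Union>d\<in>D. ball d r) = space \<nu>"
    using sets_eq_imp_space_eq[OF sets] by auto
  moreover have "emeasure \<nu> (ball d r) \<noteq> \<infinity>" for d
    using r(2)[of d] by (auto simp: top_unique)
  ultimately show ?thesis
    using D(1) by (intro sigma_finite_measure.intro exI[of _ "(\<lambda>d. ball d r) ` D"]) (auto simp: sets)
qed

lemma nn_integral_exp_abs_finite: "(\<integral>\<^sup>+x. ennreal (exp (- \<bar>x\<bar>)) \<partial>lborel) < (\<infinity>::ennreal)"
proof -
  let ?h = "\<lambda>x::real. ennreal (exp (- x)) * indicator {0..} x"
  have "(\<integral>\<^sup>+x. ?h x \<partial>lborel) = ennreal (0 - (- exp (- 0)))"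
  proof (rule nn_integral_FTC_atLeast)
    show "((\<lambda>x::real. - exp (- x)) \<longlongrightarrow> 0) at_top"
      using tendsto_minus[OF filterlim_compose[OF exp_at_bot filterlim_uminus_at_bot_at_top]] by simp
  qed (auto intro!: derivative_eq_intros)
  then have h: "(\<integral>\<^sup>+x. ?h x \<partial>lborel) = 1" by simp
  have "(\<integral>\<^sup>+x. ?h (- x) \<partial>lborel) = (\<integral>\<^sup>+x. ?h x \<partial>lborel)"
    by (subst nn_integral_real_affine[of ?h "- 1" 0]) auto
  moreover have "(\<integral>\<^sup>+x. ennreal (exp (- \<bar>x\<bar>)) \<partial>lborel) \<le> (\<integral>\<^sup>+x. ?h x + ?h (- x) \<partial>lborel)"
    by (intro nn_integral_mono) (auto simp: indicator_def abs_if)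
  ultimately show ?thesis
    by (subst (asm) nn_integral_add) (auto simp: h intro: le_less_trans)
qed

text \<open>
  The factor \<open>DIM('a)\<close> turns the Euclidean norm into an upper bound for the \<open>\<ell>\<^sup>1\<close> norm, so that the
  integrand is at most a product of functions of single coordinates.
\<close>

lemma nn_integral_exp_norm_finite:
  "(\<integral>\<^sup>+x. ennreal (exp (- real DIM('a) * norm (x::'a::euclidean_space))) \<partial>lborel) < (\<infinity>::ennreal)"
proof -
  have "exp (- real DIM('a) * norm x) \<le> (\<Prod>b\<in>Basis. exp (- \<bar>x \<bullet> b\<bar>))" for x :: 'a
  proof -
    have "(\<Sum>b\<in>Basis. \<bar>x \<bullet> b\<bar>) \<le> real DIM('a) * norm x"
      using sum_mono[of "Basis :: 'a set" "\<lambda>b. \<bar>x \<bullet> b\<bar>" "\<lambda>_. norm x"] by (simp add: Basis_le_norm)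
    then show ?thesis by (simp add: sum_negf flip: exp_sum)
  qed
  then have "(\<integral>\<^sup>+x. ennreal (exp (- real DIM('a) * norm (x::'a))) \<partial>lborel)
      \<le> (\<integral>\<^sup>+x. (\<Prod>b\<in>Basis. ennreal (exp (- \<bar>(x::'a) \<bullet> b\<bar>))) \<partial>lborel)"
    by (intro nn_integral_mono) (simp add: prod_ennreal ennreal_leI)
  also have "\<dots> = (\<Prod>b\<in>(Basis :: 'a set). (\<integral>\<^sup>+x. ennreal (exp (- \<bar>x\<bar>)) \<partial>lborel))"
    by (intro nn_integral_lborel_prod) auto
  also have "\<dots> < \<infinity>"
    using nn_integral_exp_abs_finite by (simp add: power_less_top_ennreal)
  finally show ?thesis .
qed

text \<open>
  On a ball of radius \<open>r\<close> the weight varies by a factor of at most \<open>exp (d r)\<close>. Up to that factor it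
  may therefore be replaced by its Lebesgue average over the ball about \<open>s\<close>, and after exchanging the integrals only
  the uniformly bounded quantity \<open>\<nu> (ball u r)\<close> meets the Lebesgue-integrable weight.
\<close>

lemma translation_bounded_exp_norm_integrable:
  assumes tb: "translation_bounded (\<nu> :: 'a::euclidean_space measure)"
  shows "integrable \<nu> (\<lambda>s. exp (- real DIM('a) * norm s))"
proof -
  let ?d = "real DIM('a)"
  obtain r C where sets[measurable_cong]: "sets \<nu> = sets borel"
    and r: "r > 0" "\<And>a. emeasure \<nu> (ball a r) \<le> ennreal C"
    using tb unfolding translation_bounded_def by blast
  interpret \<nu>: sigma_finite_measure \<nu>
    by (rule translation_bounded_sigma_finite[OF tb])
  interpret pair_sigma_finite "lborel :: 'a measure" \<nu> ..
  define V where "V = unit_ball_vol ?d * r ^ DIM('a)"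
  have V: "V > 0" "\<And>s::'a. emeasure lborel (ball s r) = ennreal V"
    using r(1) by (auto simp: V_def emeasure_ball)
  have "ennreal V * (\<integral>\<^sup>+s. ennreal (exp (- ?d * norm s)) \<partial>\<nu>)
      = (\<integral>\<^sup>+s. ennreal (exp (- ?d * norm s)) * (\<integral>\<^sup>+u. indicator (ball s r) u \<partial>lborel) \<partial>\<nu>)"
    by (simp add: V(2) nn_integral_cmult mult.commute)
  also have "\<dots> = (\<integral>\<^sup>+s. (\<integral>\<^sup>+u. ennreal (exp (- ?d * norm s)) * indicator {..<r} (dist s u) \<partial>lborel) \<partial>\<nu>)"
    by (subst nn_integral_cmult[symmetric])
       (auto intro!: nn_integral_cong borel_measurable_indicator simp: indicator_def)
  also have "\<dots> \<le> (\<integral>\<^sup>+s. (\<integral>\<^sup>+u. ennreal (exp (?d * r) * exp (- ?d * norm u))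
      * indicator {..<r} (dist s u) \<partial>lborel) \<partial>\<nu>)"
  proof (intro nn_integral_mono)
    fix s u :: 'a
    show "ennreal (exp (- ?d * norm s)) * indicator {..<r} (dist s u)
      \<le> ennreal (exp (?d * r) * exp (- ?d * norm u)) * indicator {..<r} (dist s u)"
    proof (cases "dist s u < r")
      case True
      then have "norm u \<le> r + norm s"
        using norm_triangle_ineq2[of u s] by (simp add: dist_norm norm_minus_commute)
      then have "?d * norm u \<le> ?d * (r + norm s)" by (intro mult_left_mono) auto
      with True show ?thesis by (simp add: algebra_simps flip: exp_add)
    qed simp
  qed
  also have "\<dots> = (\<integral>\<^sup>+u. (\<integral>\<^sup>+s. ennreal (exp (?d * r) * exp (- ?d * norm u))
      * indicator {..<r} (dist s u) \<partial>\<nu>) \<partial>lborel)"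
    by (rule Fubini') measurable
  also have "\<dots> = (\<integral>\<^sup>+u. ennreal (exp (?d * r) * exp (- ?d * norm u)) * emeasure \<nu> (ball u r) \<partial>lborel)"
  proof (intro nn_integral_cong)
    fix u :: 'a
    have "(\<integral>\<^sup>+s. ennreal (exp (?d * r) * exp (- ?d * norm u)) * indicator {..<r} (dist s u) \<partial>\<nu>)
        = (\<integral>\<^sup>+s. ennreal (exp (?d * r) * exp (- ?d * norm u)) * indicator (ball u r) s \<partial>\<nu>)"
      by (intro nn_integral_cong) (auto simp: indicator_def dist_commute)
    then show "(\<integral>\<^sup>+s. ennreal (exp (?d * r) * exp (- ?d * norm u)) * indicator {..<r} (dist s u) \<partial>\<nu>)
        = ennreal (exp (?d * r) * exp (- ?d * norm u)) * emeasure \<nu> (ball u r)"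
      by (subst (asm) nn_integral_cmult_indicator) (auto simp: sets)
  qed
  also have "\<dots> \<le> (\<integral>\<^sup>+u. ennreal (exp (?d * r)) * ennreal C * ennreal (exp (- ?d * norm (u::'a))) \<partial>lborel)"
    by (intro nn_integral_mono) (auto simp: ennreal_mult mult_ac intro!: mult_mono r(2))
  also have "\<dots> = ennreal (exp (?d * r)) * ennreal C * (\<integral>\<^sup>+u. ennreal (exp (- ?d * norm (u::'a))) \<partial>lborel)"
    by (intro nn_integral_cmult) measurable
  also have "\<dots> < \<infinity>"
    using nn_integral_exp_norm_finite[where 'a='a] by (simp add: ennreal_mult_less_top)
  finally have "(\<integral>\<^sup>+s. ennreal (exp (- ?d * norm s)) \<partial>\<nu>) < \<infinity>"
    using V(1) by (auto simp: ennreal_mult_less_top)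
  then show ?thesis
    by (intro integrableI_nonneg) auto
qed

section \<open>Differentiating convolutions with Gaussian polynomials\<close>

definition smoothing :: "('a \<Rightarrow> real) \<Rightarrow> 'a::euclidean_space measure \<Rightarrow> 'a \<Rightarrow> real" where
  "smoothing \<phi> \<nu> t = (LINT s|\<nu>. \<phi> (t - s))"

text \<open>
  A dominating function that serves all \<open>t\<close> in a bounded set at once, as needed to differentiate in
  \<open>t\<close> under the integral.
\<close>

lemma gauss_poly_translate_bound:
  fixes \<phi> :: "'a::euclidean_space \<Rightarrow> real"
  assumes "\<phi> \<in> gauss_poly"
  shows "\<exists>C\<ge>0. \<forall>t s. norm t \<le> R \<longrightarrow> \<bar>\<phi> (t - s)\<bar> \<le> C * exp (- real DIM('a) * norm s)"
proof -
  let ?d = "real DIM('a)"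
  obtain C where C: "C \<ge> 0" "\<And>x. \<bar>\<phi> x\<bar> \<le> C * exp (- ?d * norm x)"
    using gauss_poly_decay[OF assms, of ?d] by blast
  have "\<bar>\<phi> (t - s)\<bar> \<le> (C * exp (?d * R)) * exp (- ?d * norm s)" if "norm t \<le> R" for t s
  proof -
    have "norm s \<le> R + norm (t - s)"
      using norm_triangle_ineq2[of s t] that by (simp add: norm_minus_commute)
    then have "?d * norm s \<le> ?d * (R + norm (t - s))" by (intro mult_left_mono) auto
    then have "exp (- ?d * norm (t - s)) \<le> exp (?d * R) * exp (- ?d * norm s)"
      by (simp add: algebra_simps flip: exp_add)
    with C(1) have "C * exp (- ?d * norm (t - s)) \<le> C * (exp (?d * R) * exp (- ?d * norm s))"
      by (intro mult_left_mono)
    with C(2)[of "t - s"] show ?thesis by (simp add: mult.assoc)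
  qed
  with C(1) show ?thesis by (intro exI[of _ "C * exp (?d * R)"]) auto
qed

lemma gauss_poly_translate_integrable:
  fixes \<phi> :: "'a::euclidean_space \<Rightarrow> real"
  assumes tb: "translation_bounded \<nu>" and \<phi>: "\<phi> \<in> gauss_poly"
  shows "integrable \<nu> (\<lambda>s. \<phi> (t - s))"
proof -
  have sets[measurable_cong]: "sets \<nu> = sets borel"
    using tb unfolding translation_bounded_def by blast
  note [measurable] = gauss_poly_measurable[OF \<phi>]
  obtain C where C: "\<And>s. \<bar>\<phi> (t - s)\<bar> \<le> C * exp (- real DIM('a) * norm s)"
    using gauss_poly_translate_bound[OF \<phi>, of "norm t"] by blast
  show ?thesis
    by (rule Bochner_Integration.integrable_bound[OF
          integrable_mult_right[OF translation_bounded_exp_norm_integrable[OF tb], of C]])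
       (auto intro!: AE_I2 order_trans[OF C[simplified] abs_ge_self])
qed

text \<open>
  Dominated convergence for the difference quotients \<open>q y\<close> as \<open>y\<close> tends to \<open>t\<close>. By the mean value
  inequality they are dominated by the bounds on \<open>\<phi>'\<close> over the unit ball about \<open>t\<close>; for this \<open>y\<close> is
  confined to that ball, which does not affect the limit.
\<close>

lemma smoothing_has_derivative:
  fixes \<phi> :: "'a::euclidean_space \<Rightarrow> real"
  assumes tb: "translation_bounded \<nu>" and \<phi>: "\<phi> \<in> gauss_poly"
    and deriv: "\<And>x. (\<phi> has_derivative \<phi>' x) (at x)"
    and \<phi>': "\<And>v. (\<lambda>x. \<phi>' x v) \<in> gauss_poly"
  shows "(smoothing \<phi> \<nu> has_derivative (\<lambda>v. smoothing (\<lambda>x. \<phi>' x v) \<nu> t)) (at t)"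
proof -
  let ?W = "\<lambda>s::'a. exp (- real DIM('a) * norm s)"
  have sets[measurable_cong]: "sets \<nu> = sets borel"
    using tb unfolding translation_bounded_def by blast
  note [measurable] = gauss_poly_measurable[OF \<phi>] gauss_poly_measurable[OF \<phi>']
  note int = gauss_poly_translate_integrable[OF tb]
  have lin: "linear (\<phi>' x)" for x
    using deriv has_derivative_linear by blast
  obtain C where C: "\<And>b. C b \<ge> 0"
    "\<And>b x s. norm x \<le> norm t + 1 \<Longrightarrow> \<bar>\<phi>' (x - s) b\<bar> \<le> C b * ?W s"
    using gauss_poly_translate_bound[OF \<phi>', of "norm t + 1"] by metis
  \<comment> \<open>The bounds along the basis vectors add up to one for the operator norm of the derivative.\<close>
  define K where "K = (\<Sum>b\<in>Basis. C b)"
  have K: "\<bar>\<phi>' (x - s) v\<bar> \<le> K * ?W s * norm v" if x: "x \<in> ball t 1" for x s v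
  proof -
    have nx: "norm x \<le> norm t + 1"
      using x norm_triangle_ineq2[of x t] by (simp add: dist_norm norm_minus_commute)
    have "\<phi>' (x - s) v = \<phi>' (x - s) (\<Sum>b\<in>Basis. (v \<bullet> b) *\<^sub>R b)"
      by (simp add: euclidean_representation)
    also have "\<dots> = (\<Sum>b\<in>Basis. (v \<bullet> b) * \<phi>' (x - s) b)"
      by (simp add: linear_sum[OF lin] linear_cmul[OF lin])
    also have "\<bar>\<dots>\<bar> \<le> (\<Sum>b\<in>Basis. norm v * (C b * ?W s))"
      by (intro order_trans[OF sum_abs] sum_mono)
         (auto simp: abs_mult intro!: mult_mono Basis_le_norm C(2)[OF nx, simplified])
    also have "\<dots> = K * ?W s * norm v"
      by (simp add: K_def sum_distrib_left sum_distrib_right mult_ac)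
    finally show ?thesis .
  qed
  define q where "q y s = norm (\<phi> (y - s) - \<phi> (t - s) - \<phi>' (t - s) (y - t)) / norm (y - t)" for y s
  have q_le: "\<bar>q y s\<bar> \<le> 2 * K * ?W s" if y: "y \<in> ball t 1 - {t}" for y s
  proof -
    have "norm (\<phi> (y - s) - \<phi> (t - s)) \<le> K * ?W s * norm (y - t)"
    proof (rule differentiable_bound[of "ball t 1" "\<lambda>x. \<phi> (x - s)" "\<lambda>x. \<phi>' (x - s)"])
      fix x assume x: "x \<in> ball t 1"
      show "((\<lambda>x. \<phi> (x - s)) has_derivative \<phi>' (x - s)) (at x within ball t 1)"
        by (rule has_derivative_at_withinI, rule has_derivative_eq_rhs,
            rule has_derivative_compose[of "\<lambda>x. x - s", OF _ deriv])
           (auto intro!: derivative_eq_intros)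
      show "onorm (\<phi>' (x - s)) \<le> K * ?W s"
        using K[OF x] by (intro onorm_le) auto
    qed (use y in auto)
    moreover have "norm (\<phi>' (t - s) (y - t)) \<le> K * ?W s * norm (y - t)"
      using K[of t s "y - t"] by simp
    ultimately have "norm (\<phi> (y - s) - \<phi> (t - s) - \<phi>' (t - s) (y - t)) \<le> (2 * K * ?W s) * norm (y - t)"
      using norm_triangle_ineq4[of "\<phi> (y - s) - \<phi> (t - s)" "\<phi>' (t - s) (y - t)"] by linarith
    then show ?thesis
      using y by (simp add: q_def divide_le_eq)
  qed
  let ?D = "\<lambda>v. smoothing (\<lambda>x. \<phi>' x v) \<nu> t"
  have "linear ?D"
  proof
    show "?D (v + w) = ?D v + ?D w" for v w
      unfolding smoothing_def using int[OF \<phi>']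
      by (subst Bochner_Integration.integral_add[symmetric]) (auto simp: linear_add[OF lin])
    show "?D (c *\<^sub>R v) = c *\<^sub>R ?D v" for c v
      unfolding smoothing_def by (simp add: linear_cmul[OF lin])
  qed
  then have "bounded_linear ?D" by (simp add: linear_conv_bounded_linear)
  moreover have "((\<lambda>y. norm (smoothing \<phi> \<nu> y - smoothing \<phi> \<nu> t - ?D (y - t)) / norm (y - t)) \<longlongrightarrow> 0)
      (at t within ball t 1)"
    unfolding tendsto_at_iff_sequentially comp_def
  proof safe
    fix Y :: "nat \<Rightarrow> 'a"
    assume Y: "\<forall>i. Y i \<in> ball t 1 - {t}" "Y \<longlonglongrightarrow> t"
    have "(\<lambda>n. LINT s|\<nu>. q (Y n) s) \<longlonglongrightarrow> (LINT s|\<nu>. 0)"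
    proof (rule integral_dominated_convergence)
      show "integrable \<nu> (\<lambda>s. 2 * K * ?W s)"
        by (intro integrable_mult_right translation_bounded_exp_norm_integrable[OF tb])
      show "AE s in \<nu>. (\<lambda>n. q (Y n) s) \<longlonglongrightarrow> 0"
      proof (rule AE_I2)
        fix s
        have "((\<lambda>h. q (t + h) s) \<longlongrightarrow> 0) (at 0)"
          using deriv[of "t - s"] unfolding has_derivative_at q_def by (simp add: algebra_simps)
        then have "((\<lambda>y. q y s) \<longlongrightarrow> 0) (at t)"
          by (simp add: LIM_offset_zero_iff)
        then show "(\<lambda>n. q (Y n) s) \<longlonglongrightarrow> 0"
          using Y unfolding tendsto_at_iff_sequentially comp_def by auto
      qed
      show "AE s in \<nu>. norm (q (Y n) s) \<le> 2 * K * ?W s" for n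
        using q_le Y(1) by auto
    qed (unfold q_def, measurable)
    then have lim: "(\<lambda>n. LINT s|\<nu>. q (Y n) s) \<longlonglongrightarrow> 0" by simp
    show "(\<lambda>n. norm (smoothing \<phi> \<nu> (Y n) - smoothing \<phi> \<nu> t - ?D (Y n - t)) / norm (Y n - t)) \<longlonglongrightarrow> 0"
    proof (rule Lim_null_comparison[OF _ lim], intro always_eventually allI)
      fix n
      have "smoothing \<phi> \<nu> (Y n) - smoothing \<phi> \<nu> t - ?D (Y n - t)
          = (LINT s|\<nu>. \<phi> (Y n - s) - \<phi> (t - s) - \<phi>' (t - s) (Y n - t))"
        unfolding smoothing_def using int[OF \<phi>] int[OF \<phi>'] by simp
      then have "norm (smoothing \<phi> \<nu> (Y n) - smoothing \<phi> \<nu> t - ?D (Y n - t))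
          \<le> (LINT s|\<nu>. norm (\<phi> (Y n - s) - \<phi> (t - s) - \<phi>' (t - s) (Y n - t)))"
        by (simp only: integral_norm_bound)
      then show "norm (norm (smoothing \<phi> \<nu> (Y n) - smoothing \<phi> \<nu> t - ?D (Y n - t)) / norm (Y n - t))
          \<le> (LINT s|\<nu>. q (Y n) s)"
        unfolding q_def by (simp add: divide_right_mono)
    qed
  qed
  ultimately have "(smoothing \<phi> \<nu> has_derivative ?D) (at t within ball t 1)"
    unfolding has_derivative_iff_norm by blast
  then show ?thesis
    by (simp add: at_within_open[of t "ball t 1"])
qed

lemma smoothing_C_infinity:
  assumes tb: "translation_bounded \<nu>" and "\<phi> \<in> gauss_poly"
  shows "C_infinity (smoothing \<phi> \<nu>)"
  unfolding C_infinity_def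
proof
  fix k
  show "C_k k (smoothing \<phi> \<nu>)"
    using assms(2)
  proof (induction k arbitrary: \<phi>)
    case (0 \<phi>)
    obtain \<phi>' where "\<And>x. (\<phi> has_derivative \<phi>' x) (at x)" "\<And>v. (\<lambda>x. \<phi>' x v) \<in> gauss_poly"
      using gauss_poly_derivative[OF 0] by blast
    note smoothing_has_derivative[OF tb 0 this]
    then show ?case
      by (auto intro!: continuous_at_imp_continuous_on has_derivative_continuous)
  next
    case (Suc k \<phi>)
    obtain \<phi>' where \<phi>': "\<And>x. (\<phi> has_derivative \<phi>' x) (at x)" "\<And>v. (\<lambda>x. \<phi>' x v) \<in> gauss_poly"
      using gauss_poly_derivative[OF Suc.prems] by blast
    note deriv = smoothing_has_derivative[OF tb Suc.prems \<phi>']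
    have "frechet_derivative (smoothing \<phi> \<nu>) (at t) v = smoothing (\<lambda>x. \<phi>' x v) \<nu> t" for t v
      using frechet_derivative_at[OF deriv] by metis
    moreover have "smoothing \<phi> \<nu> differentiable (at t)" for t
      using deriv differentiable_def by blast
    ultimately show ?case
      using Suc.IH[OF \<phi>'(2)] by simp
  qed
qed

section \<open>Modulations and the Fourier transform\<close>

definition modulate :: "'a::euclidean_space \<Rightarrow> ('a \<Rightarrow> complex) \<Rightarrow> 'a \<Rightarrow> complex" where
  "modulate u f x = f x * exp (- (2 * complex_of_real pi * \<i> * complex_of_real (u \<bullet> x)))"

lemma norm_character [simp]:
  "cmod (exp (- (2 * complex_of_real pi * \<i> * complex_of_real c))) = 1"
proof -
  have "- (2 * complex_of_real pi * \<i> * complex_of_real c) = \<i> * complex_of_real (- 2 * pi * c)"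
    by simp
  then show ?thesis by (metis norm_exp_i_times)
qed

lemma norm_modulate [simp]: "cmod (modulate u f x) = cmod (f x)"
  by (simp add: modulate_def norm_mult)

lemma fourier_modulate: "fourier \<mu> (modulate u f) s = fourier \<mu> f (u + s)"
  unfolding fourier_def modulate_def
  by (intro arg_cong2[where f=lebesgue_integral] refl ext)
     (simp add: mult.assoc inner_add_left ring_distribs flip: exp_add)

lemma L2_norm_sq_modulate: "L2_norm_sq \<mu> (modulate u f) = L2_norm_sq \<mu> f"
  by (simp add: L2_norm_sq_def)

lemma modulate_in_L2:
  assumes [measurable_cong]: "sets \<mu> = sets borel" and "f \<in> L2 \<mu>"
  shows "modulate u f \<in> L2 \<mu>"
proof -
  have [measurable]: "f \<in> borel_measurable \<mu>" using assms unfolding L2_def by blast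
  have "modulate u f \<in> borel_measurable \<mu>" unfolding modulate_def[abs_def] by measurable
  with assms show ?thesis unfolding L2_def by simp
qed

lemma fourier_measurable:
  assumes "prob_space \<mu>" and [measurable_cong]: "sets \<mu> = sets borel"
    and [measurable]: "f \<in> borel_measurable \<mu>"
  shows "fourier \<mu> f \<in> borel_measurable borel"
proof -
  interpret prob_space \<mu> by fact
  show ?thesis unfolding fourier_def[abs_def] by measurable
qed

lemma fourier_one_continuous_at_0:
  assumes "prob_space \<mu>" and [measurable_cong]: "sets \<mu> = sets borel"
  shows "isCont (fourier \<mu> (\<lambda>_. 1)) 0"
proof -
  interpret prob_space \<mu> by fact
  show ?thesis
  proof (rule continuous_at_sequentiallyI)
    fix u :: "nat \<Rightarrow> 'a" assume u: "u \<longlonglongrightarrow> 0"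
    show "(\<lambda>n. fourier \<mu> (\<lambda>_. 1) (u n)) \<longlonglongrightarrow> fourier \<mu> (\<lambda>_. 1) 0"
      unfolding fourier_def
    proof (rule integral_dominated_convergence[where w="\<lambda>_. 1"])
      show "AE x in \<mu>. (\<lambda>n. 1 * exp (- (2 * complex_of_real pi * \<i> * complex_of_real (u n \<bullet> x))))
          \<longlonglongrightarrow> 1 * exp (- (2 * complex_of_real pi * \<i> * complex_of_real (0 \<bullet> x)))"
        by (intro AE_I2 tendsto_intros u)
    qed auto
  qed
qed

text \<open>
  The transform of the constant \<open>1\<close> is continuous with value \<open>1\<close> at the origin, so its modulus is at
  least \<open>1/2\<close> on some ball of radius \<open>r\<close> about \<open>0\<close>. Modulating by \<open>- a\<close> moves this ball to \<open>a\<close>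
  without changing the norm in \<open>L\<^sup>2(\<mu>)\<close>, and the Bessel bound becomes \<open>\<nu> (ball a r) \<le> 4 B\<close>.
\<close>

lemma bessel_imp_translation_bounded:
  assumes \<mu>: "prob_space \<mu>" "sets \<mu> = sets borel" and \<nu>: "bessel_measure \<mu> \<nu>"
  shows "translation_bounded \<nu>"
proof -
  interpret prob_space \<mu> by fact
  let ?F = "fourier \<mu> (\<lambda>_. 1)"
  have one: "(\<lambda>_. 1) \<in> L2 \<mu>" "L2_norm_sq \<mu> (\<lambda>_. 1) = 1"
    by (auto simp: L2_def L2_norm_sq_def emeasure_space_1)
  obtain B where sets[measurable_cong]: "sets \<nu> = sets borel"
    and B: "B > 0" "\<And>f. f \<in> L2 \<mu> \<Longrightarrow> L2_norm_sq \<nu> (fourier \<mu> f) \<le> ennreal B * L2_norm_sq \<mu> f"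
    using \<nu> unfolding bessel_measure_def by blast
  have "?F 0 = 1"
    by (simp add: fourier_def prob_space)
  then have "\<exists>r>0. \<forall>y. dist y 0 < r \<longrightarrow> dist (?F y) 1 < 1 / 2"
    using fourier_one_continuous_at_0[OF \<mu>] unfolding continuous_at_eps_delta
    by (metis half_gt_zero zero_less_one)
  then obtain r where r: "r > 0" "\<And>y. norm y < r \<Longrightarrow> norm (?F y - 1) < 1 / 2"
    by (auto simp: dist_norm)
  have half: "1 \<le> 4 * (cmod (?F y))\<^sup>2" if "norm y < r" for y
  proof -
    have "1 / 2 \<le> cmod (?F y)"
      using r(2)[OF that] norm_triangle_ineq2[of 1 "?F y"] by (simp add: norm_minus_commute)
    then have "(1 / 2)\<^sup>2 \<le> (cmod (?F y))\<^sup>2" by (intro power_mono) auto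
    then show ?thesis by (simp add: power2_eq_square)
  qed
  have "emeasure \<nu> (ball a r) \<le> ennreal (4 * B)" for a
  proof -
    let ?f = "modulate (- a) (\<lambda>_. 1)"
    have f: "?f \<in> L2 \<mu>" by (rule modulate_in_L2[OF \<mu>(2) one(1)])
    then have [measurable]: "fourier \<mu> ?f \<in> borel_measurable borel"
      by (intro fourier_measurable \<mu>) (simp add: L2_def)
    have "emeasure \<nu> (ball a r) = (\<integral>\<^sup>+s. indicator (ball a r) s \<partial>\<nu>)"
      by (simp add: sets)
    also have "\<dots> \<le> (\<integral>\<^sup>+s. 4 * ennreal ((cmod (fourier \<mu> ?f s))\<^sup>2) \<partial>\<nu>)"
    proof (intro nn_integral_mono)
      fix s
      have "1 \<le> ennreal (4 * (cmod (?F (- a + s)))\<^sup>2)" if "s \<in> ball a r"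
        using half[of "- a + s"] that by (simp add: dist_norm norm_minus_commute)
      then show "indicator (ball a r) s \<le> 4 * ennreal ((cmod (fourier \<mu> ?f s))\<^sup>2)"
        by (simp add: fourier_modulate ennreal_mult indicator_def)
    qed
    also have "\<dots> = 4 * L2_norm_sq \<nu> (fourier \<mu> ?f)"
      unfolding L2_norm_sq_def by (intro nn_integral_cmult) measurable
    also have "\<dots> \<le> 4 * ennreal B"
      using B(2)[OF f] by (intro mult_left_mono) (auto simp: L2_norm_sq_modulate one)
    finally show ?thesis using B(1) by (simp add: ennreal_mult)
  qed
  with r(1) show ?thesis unfolding translation_bounded_def using sets by blast
qed

section \<open>Gaussian averages of translates\<close>

definition gaussian :: "'a::euclidean_space \<Rightarrow> real" where
  "gaussian x = exp (- (norm x)\<^sup>2)"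

lemma gaussian_gauss_poly: "gaussian \<in> gauss_poly"
  unfolding gaussian_def[abs_def] by (rule gauss_poly.gauss)

lemma gaussian_measurable [measurable]: "gaussian \<in> borel_measurable borel"
  by (rule gauss_poly_measurable[OF gaussian_gauss_poly])

lemma gaussian_nonneg [simp]: "0 \<le> gaussian x"
  by (simp add: gaussian_def)

text \<open>
  The convolution of \<open>\<nu>\<close> with the Gaussian, given by its density so that absolute continuity is built
  in. That it averages the translates of \<open>\<nu>\<close> is the content of \<open>nn_integral_gaussian_average\<close>.
\<close>

definition gaussian_average :: "'a::euclidean_space measure \<Rightarrow> 'a measure" where
  "gaussian_average \<nu> = density lborel (\<lambda>t. ennreal (smoothing gaussian \<nu> t))"

lemma smoothing_gaussian_measurable:
  assumes "translation_bounded \<nu>"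
  shows "smoothing gaussian \<nu> \<in> borel_measurable borel"
proof -
  have "C_k 0 (smoothing gaussian \<nu>)"
    using smoothing_C_infinity[OF assms gaussian_gauss_poly] unfolding C_infinity_def by blast
  then show ?thesis by (simp add: borel_measurable_continuous_onI)
qed

lemma gaussian_average_smooth:
  assumes "translation_bounded \<nu>"
  shows "ac_with_smooth_RN_deriv (gaussian_average \<nu>)"
  unfolding ac_with_smooth_RN_deriv_def
proof (intro conjI exI[of _ "smoothing gaussian \<nu>"] allI)
  note [measurable] = smoothing_gaussian_measurable[OF assms]
  show "absolutely_continuous lborel (gaussian_average \<nu>)"
    unfolding gaussian_average_def by (rule absolutely_continuousI_density) measurable
  show "C_infinity (smoothing gaussian \<nu>)"
    by (rule smoothing_C_infinity[OF assms gaussian_gauss_poly])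
  show "0 \<le> smoothing gaussian \<nu> x" for x
    unfolding smoothing_def by (intro Bochner_Integration.integral_nonneg) simp
  have "AE x in lborel. ennreal (smoothing gaussian \<nu> x) = RN_deriv lborel (gaussian_average \<nu>) x"
    unfolding gaussian_average_def by (rule sigma_finite_measure.RN_deriv_unique[OF sigma_finite_lborel]) auto
  then show "AE x in lborel. RN_deriv lborel (gaussian_average \<nu>) x = ennreal (smoothing gaussian \<nu> x)"
    by (simp add: eq_commute)
qed

text \<open>
  Tonelli's theorem together with the substitution \<open>t = u + s\<close>, which is where translation invariance
  of Lebesgue measure enters.
\<close>

lemma nn_integral_gaussian_average:
  fixes \<nu> :: "'a::euclidean_space measure"
  assumes tb: "translation_bounded \<nu>" and [measurable]: "h \<in> borel_measurable borel"
  shows "(\<integral>\<^sup>+t. h t \<partial>gaussian_average \<nu>)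
    = (\<integral>\<^sup>+u. ennreal (gaussian u) * (\<integral>\<^sup>+s. h (u + s) \<partial>\<nu>) \<partial>lborel)"
proof -
  have sets[measurable_cong]: "sets \<nu> = sets borel"
    using tb unfolding translation_bounded_def by blast
  interpret \<nu>: sigma_finite_measure \<nu>
    by (rule translation_bounded_sigma_finite[OF tb])
  interpret pair_sigma_finite "lborel :: 'a measure" \<nu> ..
  note [measurable] = smoothing_gaussian_measurable[OF tb]
  have dens: "ennreal (smoothing gaussian \<nu> t) = (\<integral>\<^sup>+s. ennreal (gaussian (t - s)) \<partial>\<nu>)" for t
    unfolding smoothing_def
    by (intro nn_integral_eq_integral[symmetric] gauss_poly_translate_integrable[OF tb gaussian_gauss_poly]) auto
  have "(\<integral>\<^sup>+t. h t \<partial>gaussian_average \<nu>) = (\<integral>\<^sup>+t. ennreal (smoothing gaussian \<nu> t) * h t \<partial>lborel)"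
    unfolding gaussian_average_def by (intro nn_integral_density) measurable
  also have "\<dots> = (\<integral>\<^sup>+t. (\<integral>\<^sup>+s. ennreal (gaussian (t - s)) * h t \<partial>\<nu>) \<partial>lborel)"
    unfolding dens by (intro nn_integral_cong nn_integral_multc[symmetric]) measurable
  also have "\<dots> = (\<integral>\<^sup>+s. (\<integral>\<^sup>+t. ennreal (gaussian (t - s)) * h t \<partial>lborel) \<partial>\<nu>)"
    by (rule Fubini'[symmetric]) measurable
  also have "\<dots> = (\<integral>\<^sup>+s. (\<integral>\<^sup>+u. ennreal (gaussian u) * h (u + s) \<partial>lborel) \<partial>\<nu>)"
  proof (rule nn_integral_cong)
    fix s :: 'a
    have "(\<integral>\<^sup>+t. ennreal (gaussian (t - s)) * h t \<partial>lborel)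
        = (\<integral>\<^sup>+t. ennreal (gaussian (t - s)) * h t \<partial>distr lborel borel ((+) s))"
      by (simp add: lborel_distr_plus)
    also have "\<dots> = (\<integral>\<^sup>+u. ennreal (gaussian u) * h (u + s) \<partial>lborel)"
      by (subst nn_integral_distr) (auto simp: add.commute)
    finally show "(\<integral>\<^sup>+t. ennreal (gaussian (t - s)) * h t \<partial>lborel)
        = (\<integral>\<^sup>+u. ennreal (gaussian u) * h (u + s) \<partial>lborel)" .
  qed
  also have "\<dots> = (\<integral>\<^sup>+u. (\<integral>\<^sup>+s. ennreal (gaussian u) * h (u + s) \<partial>\<nu>) \<partial>lborel)"
    by (rule Fubini') measurable
  also have "\<dots> = (\<integral>\<^sup>+u. ennreal (gaussian u) * (\<integral>\<^sup>+s. h (u + s) \<partial>\<nu>) \<partial>lborel)"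
    by (intro nn_integral_cong nn_integral_cmult) measurable
  finally show ?thesis .
qed

text \<open>
  The norm for the averaged measure is an average of norms for \<open>\<nu>\<close> itself, taken over modulations
  of \<open>f\<close>. Since these all have the norm of \<open>f\<close> in \<open>L\<^sup>2(\<mu>)\<close>, any two-sided bound for \<open>\<nu>\<close> can be applied
  inside the integral.
\<close>

lemma L2_norm_sq_gaussian_average:
  assumes \<mu>: "prob_space \<mu>" "sets \<mu> = sets borel" and tb: "translation_bounded \<nu>" and f: "f \<in> L2 \<mu>"
  shows "L2_norm_sq (gaussian_average \<nu>) (fourier \<mu> f)
    = (\<integral>\<^sup>+u. ennreal (gaussian u) * L2_norm_sq \<nu> (fourier \<mu> (modulate u f)) \<partial>lborel)"
proof -
  have [measurable]: "fourier \<mu> f \<in> borel_measurable borel"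
    using f by (intro fourier_measurable \<mu>) (simp add: L2_def)
  show ?thesis
    unfolding L2_norm_sq_def fourier_modulate
    by (rule nn_integral_gaussian_average[OF tb]) measurable
qed

text \<open>
  Finiteness of the mass keeps the upper bound and positivity keeps the lower one: averaging
  multiplies the constants \<open>A\<close> and \<open>B\<close> by this mass.
\<close>

lemma gaussian_mass:
  "\<exists>I>0. (\<integral>\<^sup>+u. ennreal (gaussian (u::'a::euclidean_space)) \<partial>lborel) = ennreal I"
proof -
  let ?d = "real DIM('a)" and ?I = "\<integral>\<^sup>+u. ennreal (gaussian (u::'a)) \<partial>lborel"
  obtain C where C: "C \<ge> 0" "\<And>x::'a. \<bar>gaussian x\<bar> \<le> C * exp (- ?d * norm x)"
    using gauss_poly_decay[OF gaussian_gauss_poly, of ?d] by blast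
  have "?I \<le> (\<integral>\<^sup>+u. ennreal C * ennreal (exp (- ?d * norm (u::'a))) \<partial>lborel)"
    using C by (intro nn_integral_mono) (simp flip: ennreal_mult)
  also have "\<dots> = ennreal C * (\<integral>\<^sup>+u. ennreal (exp (- ?d * norm (u::'a))) \<partial>lborel)"
    by (intro nn_integral_cmult) measurable
  also have "\<dots> < \<infinity>"
    using nn_integral_exp_norm_finite[where 'a='a] by (simp add: ennreal_mult_less_top)
  finally have fin: "?I < \<infinity>" .
  have "?I \<noteq> 0"
  proof
    assume "?I = 0"
    then have "AE u::'a in lborel. False"
      by (subst (asm) nn_integral_0_iff_AE) (auto simp: gaussian_def ennreal_eq_0_iff not_le)
    then show False
      using AE_iff_null_sets[of "UNIV :: 'a set" lborel] by (simp add: null_sets_def)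
  qed
  then have "ennreal (enn2real ?I) = ?I" "enn2real ?I > 0"
    using fin by (auto simp: enn2real_positive_iff zero_less_iff_neq_zero)
  then show ?thesis by metis
qed

lemma frame_imp_bessel: "frame_measure \<mu> \<nu> \<Longrightarrow> bessel_measure \<mu> \<nu>"
  unfolding frame_measure_def bessel_measure_def by blast

lemma gaussian_average_bessel:
  fixes \<mu> :: "'a::euclidean_space measure"
  assumes \<mu>: "prob_space \<mu>" "sets \<mu> = sets borel" and \<nu>: "bessel_measure \<mu> \<nu>"
  shows "bessel_measure \<mu> (gaussian_average \<nu>)"
proof -
  note tb = bessel_imp_translation_bounded[OF \<mu> \<nu>]
  obtain I where I: "I > 0" "(\<integral>\<^sup>+u. ennreal (gaussian (u::'a)) \<partial>lborel) = ennreal I"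
    using gaussian_mass by blast
  obtain B where B: "B > 0" "\<And>f. f \<in> L2 \<mu> \<Longrightarrow> L2_norm_sq \<nu> (fourier \<mu> f) \<le> ennreal B * L2_norm_sq \<mu> f"
    using \<nu> unfolding bessel_measure_def by blast
  have "L2_norm_sq (gaussian_average \<nu>) (fourier \<mu> f) \<le> ennreal (I * B) * L2_norm_sq \<mu> f"
    if f: "f \<in> L2 \<mu>" for f
  proof -
    have pointwise: "L2_norm_sq \<nu> (fourier \<mu> (modulate u f)) \<le> ennreal B * L2_norm_sq \<mu> f" for u
      using B(2)[OF modulate_in_L2[OF \<mu>(2) f, of u]] by (simp add: L2_norm_sq_modulate)
    have "L2_norm_sq (gaussian_average \<nu>) (fourier \<mu> f)
        \<le> (\<integral>\<^sup>+u. ennreal (gaussian (u::'a)) * (ennreal B * L2_norm_sq \<mu> f) \<partial>lborel)"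
      unfolding L2_norm_sq_gaussian_average[OF \<mu> tb f]
      by (intro nn_integral_mono mult_left_mono pointwise) auto
    also have "\<dots> = ennreal I * (ennreal B * L2_norm_sq \<mu> f)"
      by (simp add: nn_integral_multc I(2))
    finally show ?thesis using I(1) B(1) by (simp add: ennreal_mult mult.assoc)
  qed
  moreover have "I * B > 0" using I(1) B(1) by simp
  ultimately show ?thesis
    unfolding bessel_measure_def gaussian_average_def by auto
qed

lemma gaussian_average_frame:
  fixes \<mu> :: "'a::euclidean_space measure"
  assumes \<mu>: "prob_space \<mu>" "sets \<mu> = sets borel" and \<nu>: "frame_measure \<mu> \<nu>"
  shows "frame_measure \<mu> (gaussian_average \<nu>)"
proof -
  note bessel = frame_imp_bessel[OF \<nu>]
  note tb = bessel_imp_translation_bounded[OF \<mu> bessel]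
  obtain I where I: "I > 0" "(\<integral>\<^sup>+u. ennreal (gaussian (u::'a)) \<partial>lborel) = ennreal I"
    using gaussian_mass by blast
  obtain A where A: "A > 0" "\<And>f. f \<in> L2 \<mu> \<Longrightarrow> ennreal A * L2_norm_sq \<mu> f \<le> L2_norm_sq \<nu> (fourier \<mu> f)"
    using \<nu> unfolding frame_measure_def by blast
  have "ennreal (I * A) * L2_norm_sq \<mu> f \<le> L2_norm_sq (gaussian_average \<nu>) (fourier \<mu> f)"
    if f: "f \<in> L2 \<mu>" for f
  proof -
    have pointwise: "ennreal A * L2_norm_sq \<mu> f \<le> L2_norm_sq \<nu> (fourier \<mu> (modulate u f))" for u
      using A(2)[OF modulate_in_L2[OF \<mu>(2) f, of u]] by (simp add: L2_norm_sq_modulate)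
    have "ennreal (I * A) * L2_norm_sq \<mu> f = ennreal I * (ennreal A * L2_norm_sq \<mu> f)"
      using I(1) A(1) by (simp add: ennreal_mult mult.assoc)
    also have "\<dots> = (\<integral>\<^sup>+u. ennreal (gaussian (u::'a)) * (ennreal A * L2_norm_sq \<mu> f) \<partial>lborel)"
      by (simp add: nn_integral_multc I(2))
    also have "\<dots> \<le> L2_norm_sq (gaussian_average \<nu>) (fourier \<mu> f)"
      unfolding L2_norm_sq_gaussian_average[OF \<mu> tb f]
      by (intro nn_integral_mono mult_left_mono pointwise) auto
    finally show ?thesis .
  qed
  moreover have "I * A > 0" using I(1) A(1) by simp
  ultimately show ?thesis
    using gaussian_average_bessel[OF \<mu> bessel]
    unfolding bessel_measure_def frame_measure_def by blast
qed

theorem corollary2p5: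
  fixes \<mu> :: "(real ^ 'd) measure"
  assumes "prob_space \<mu>" and "sets \<mu> = sets borel"
  shows "((\<exists>\<nu>. bessel_measure \<mu> \<nu>) \<longrightarrow>
            (\<exists>\<nu>. bessel_measure \<mu> \<nu> \<and> ac_with_smooth_RN_deriv \<nu>)) \<and>
         ((\<exists>\<nu>. frame_measure \<mu> \<nu>) \<longrightarrow>
            (\<exists>\<nu>. frame_measure \<mu> \<nu> \<and> ac_with_smooth_RN_deriv \<nu>))"
proof (intro conjI impI)
  assume "\<exists>\<nu>. bessel_measure \<mu> \<nu>"
  then show "\<exists>\<nu>. bessel_measure \<mu> \<nu> \<and> ac_with_smooth_RN_deriv \<nu>"
    using gaussian_average_bessel[OF assms] gaussian_average_smooth
      bessel_imp_translation_bounded[OF assms] by blast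
next
  assume "\<exists>\<nu>. frame_measure \<mu> \<nu>"
  then show "\<exists>\<nu>. frame_measure \<mu> \<nu> \<and> ac_with_smooth_RN_deriv \<nu>"
    using gaussian_average_frame[OF assms] gaussian_average_smooth
      bessel_imp_translation_bounded[OF assms] frame_imp_bessel by blast
qed

end
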